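(* Let $k$ be a field, let $R = k[x_1,\ldots,x_n]$ with its standard grading, and let $M \subseteq R$ be a monomial ideal. For an ideal $I \subseteq R$, let $\operatorname{mono}(I)$ denote the ideal generated by all monomials contained in $I$. The following are equivalent: (1) There exists a graded (homogeneous) ideal $I$ of $R$ that is not a monomial ideal such that $\operatorname{mono}(I) = M$. (2) There exist $t \ge 2$ pairwise distinct monomials $u_1,\ldots,u_t$ not contained in $M$ and all of the same degree, such that $M : u_i = M : u_j$ for all $i,j$. (3) There exist monomials $u_1 \neq u_2$ with $u_1,u_2 \notin M$, $\deg u_1 = \deg u_2$ and $M : u_1 = M : u_2$.
   Context: A monomial is a product $x_1^{a_1}\cdots x_n^{a_n}$ with $a_i \ge 0$; a monomial ideal is an ideal generated by monomials. $M : u = \{r \in R \mid ru \in M\}$. *)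

theory Defs
  imports "HOL-Algebra.Ideal" "HOL-Library.Poly_Mapping"
begin

text \<open>
  The polynomial ring \<open>k[x\<^sub>1, \<dots>, x\<^sub>n]\<close> is rendered as follows.  An exponent vector is a finitely
  supported function \<open>nat \<Rightarrow>\<^sub>0 nat\<close>, and a polynomial is a finitely supported function from exponent
  vectors to coefficients; on these, \<open>+\<close> and \<open>*\<close> (convolution) of \<open>Poly_Mapping\<close> are the usual
  addition and multiplication of polynomials.  The carrier consists of the polynomials that
  involve no variables besides \<open>x\<^sub>1, \<dots>, x\<^sub>n\<close>.  The case \<open>n = 0\<close> (where the ring is \<open>k\<close>) is included.
\<close>

type_synonym 'k mpoly = "(nat \<Rightarrow>\<^sub>0 nat) \<Rightarrow>\<^sub>0 'k"

definition exponents :: "nat \<Rightarrow> (nat \<Rightarrow>\<^sub>0 nat) set"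
  where "exponents n = {a. Poly_Mapping.keys a \<subseteq> {1..n}}"

definition poly_ring :: "nat \<Rightarrow> ('k::field) mpoly ring"
  where "poly_ring n =
    \<lparr>carrier = {p. Poly_Mapping.keys p \<subseteq> exponents n},
     monoid.mult = times, one = 1, zero = 0, add = plus\<rparr>"

definition monomials :: "nat \<Rightarrow> ('k::field) mpoly set"
  where "monomials n = (\<lambda>a. Poly_Mapping.single a 1) ` exponents n"

definition exp_degree :: "(nat \<Rightarrow>\<^sub>0 nat) \<Rightarrow> nat"
  where "exp_degree a = (\<Sum>i\<in>Poly_Mapping.keys a. Poly_Mapping.lookup a i)"

text \<open>The total degree; the zero polynomial gets degree \<open>0\<close> by convention.\<close>

definition total_degree :: "('k::field) mpoly \<Rightarrow> nat"
  where "total_degree p = Max (insert 0 (exp_degree ` Poly_Mapping.keys p))"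

definition homogeneous_component :: "nat \<Rightarrow> ('k::field) mpoly \<Rightarrow> 'k mpoly"
  where "homogeneous_component d p =
    (\<Sum>a\<in>{a \<in> Poly_Mapping.keys p. exp_degree a = d}.
       Poly_Mapping.single a (Poly_Mapping.lookup p a))"

text \<open>
  An ideal \<open>I\<close> is graded iff \<open>I\<close> is the direct sum of the \<open>I \<inter> R\<^sub>d\<close>, that is, iff it contains
  every homogeneous component of each of its elements.
\<close>

definition graded_ideal :: "nat \<Rightarrow> ('k::field) mpoly set \<Rightarrow> bool"
  where "graded_ideal n I \<longleftrightarrow>
    ideal I (poly_ring n) \<and> (\<forall>p\<in>I. \<forall>d. homogeneous_component d p \<in> I)"

definition monomial_ideal :: "nat \<Rightarrow> ('k::field) mpoly set \<Rightarrow> bool"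
  where "monomial_ideal n I \<longleftrightarrow> (\<exists>S\<subseteq>monomials n. I = Idl\<^bsub>poly_ring n\<^esub> S)"

definition mono_ideal :: "nat \<Rightarrow> ('k::field) mpoly set \<Rightarrow> 'k mpoly set"
  where "mono_ideal n I = Idl\<^bsub>poly_ring n\<^esub> (I \<inter> monomials n)"

definition colon :: "nat \<Rightarrow> ('k::field) mpoly set \<Rightarrow> 'k mpoly \<Rightarrow> 'k mpoly set"
  where "colon n M u = {r \<in> carrier (poly_ring n). r \<otimes>\<^bsub>poly_ring n\<^esub> u \<in> M}"

lemma exponents_add: "a \<in> exponents n \<Longrightarrow> b \<in> exponents n \<Longrightarrow> a + b \<in> exponents n"
  using Poly_Mapping.keys_add[of a b] by (auto simp: exponents_def)

lemma cring_poly_ring: "cring (poly_ring n :: ('k::field) mpoly ring)"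
proof (rule cringI)
  let ?R = "poly_ring n :: 'k mpoly ring"
  show "abelian_group ?R"
  proof (rule abelian_groupI)
    fix x y assume "x \<in> carrier ?R" "y \<in> carrier ?R"
    then show "x \<oplus>\<^bsub>?R\<^esub> y \<in> carrier ?R"
      using Poly_Mapping.keys_add[of x y] by (auto simp: poly_ring_def)
  next
    fix x assume "x \<in> carrier ?R"
    then show "\<exists>y\<in>carrier ?R. y \<oplus>\<^bsub>?R\<^esub> x = \<zero>\<^bsub>?R\<^esub>"
      by (intro bexI[of _ "- x"]) (auto simp: poly_ring_def)
  qed (auto simp: poly_ring_def add_ac)
  show "comm_monoid ?R"
  proof (rule comm_monoidI)
    fix x y assume "x \<in> carrier ?R" "y \<in> carrier ?R"
    then show "x \<otimes>\<^bsub>?R\<^esub> y \<in> carrier ?R"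
      using Poly_Mapping.keys_mult[of x y] exponents_add[of _ n]
      by (fastforce simp: poly_ring_def)
  qed (auto simp: poly_ring_def exponents_def mult_ac)
qed (auto simp: poly_ring_def distrib_right)

end

(*
  A graded non-monomial ideal I contains a homogeneous polynomial f outside M with as few terms as
  possible.  It has at least two terms, all outside M.  If a monomial m multiplies one term of f
  into M, then m f minus that term has fewer terms than f, so it lies in M by minimality, and m
  multiplies the other terms into M as well.  Hence all terms of f have the same colon ideal.

  Conversely, given u1 and u2, sum the coefficients of a homogeneous polynomial at the monomials
  outside M.  This functional kills M and all multiples of u1 - u2, because u1 and u2 have the same
  colon ideal, but it is 1 on every monomial outside M.  Let I be the largest graded ideal on which
  it vanishes.  Then mono(I) = M, and I contains u1 - u2 but neither u1 nor u2, so it is not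
  monomial.
*)
theory Submission
  imports Defs
begin

section \<open>Polynomials as sums of terms\<close>

lemma sum_single_lookup:
  "(\<Sum>a\<in>Poly_Mapping.keys p. Poly_Mapping.single a (Poly_Mapping.lookup p a)) = p"
  by (rule poly_mapping_eqI) (auto simp: lookup_sum lookup_single when_def in_keys_iff)

lemma single_1_eq_iff:
  "Poly_Mapping.single a (1::'k::field) = Poly_Mapping.single b 1 \<longleftrightarrow> a = b"
proof
  assume "Poly_Mapping.single a (1::'k) = Poly_Mapping.single b 1"
  then have "Poly_Mapping.keys (Poly_Mapping.single a (1::'k)) =
      Poly_Mapping.keys (Poly_Mapping.single b (1::'k))" by (rule arg_cong)
  then show "a = b" by simp
qed simp

lemma single_times_eq_sum:
  fixes p :: "('k::field) mpoly"
  shows "Poly_Mapping.single c k * p =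
    (\<Sum>a\<in>Poly_Mapping.keys p. Poly_Mapping.single (c + a) (k * Poly_Mapping.lookup p a))"
  using sum_distrib_left[of "Poly_Mapping.single c k"
      "\<lambda>a. Poly_Mapping.single a (Poly_Mapping.lookup p a)" "Poly_Mapping.keys p"]
  by (simp only: sum_single_lookup mult_single)

lemma lookup_single_times:
  fixes p :: "('k::field) mpoly"
  shows "Poly_Mapping.lookup (Poly_Mapping.single c k * p) (c + a) = k * Poly_Mapping.lookup p a"
  by (auto simp: single_times_eq_sum lookup_sum lookup_single when_def in_keys_iff)

text \<open>Multiplication by a nonzero term neither cancels nor merges terms: the shift by
  \<open>c\<close> is injective, and a product of nonzero field elements is nonzero. In particular
  it preserves the number of terms.\<close>

lemma keys_single_times:
  fixes p :: "('k::field) mpoly"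
  assumes "k \<noteq> 0"
  shows "Poly_Mapping.keys (Poly_Mapping.single c k * p) = (+) c ` Poly_Mapping.keys p"
proof
  show "Poly_Mapping.keys (Poly_Mapping.single c k * p) \<subseteq> (+) c ` Poly_Mapping.keys p"
    using keys_mult[of "Poly_Mapping.single c k" p] by (auto split: if_splits)
  show "(+) c ` Poly_Mapping.keys p \<subseteq> Poly_Mapping.keys (Poly_Mapping.single c k * p)"
    using assms by (auto simp: in_keys_iff lookup_single_times)
qed

lemma keys_minus_term:
  fixes p :: "('k::field) mpoly"
  shows "Poly_Mapping.keys (p - Poly_Mapping.single a (Poly_Mapping.lookup p a)) =
    Poly_Mapping.keys p - {a}"
  by (auto simp: in_keys_iff lookup_minus lookup_single when_def split: if_splits)

lemma exp_degree_add: "exp_degree (a + b) = exp_degree a + exp_degree b"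
  unfolding exp_degree_def by (rule setsum_keys_plus_distrib) auto

lemma total_degree_single:
  "k \<noteq> 0 \<Longrightarrow> total_degree (Poly_Mapping.single a k) = exp_degree a"
  by (simp add: total_degree_def)

lemma lookup_homogeneous_component:
  "Poly_Mapping.lookup (homogeneous_component d p) a =
    (if exp_degree a = d then Poly_Mapping.lookup p a else 0)"
  by (auto simp: homogeneous_component_def lookup_sum lookup_single when_def in_keys_iff)

lemma keys_homogeneous_component:
  "Poly_Mapping.keys (homogeneous_component d p) = {a \<in> Poly_Mapping.keys p. exp_degree a = d}"
  by (auto simp: in_keys_iff lookup_homogeneous_component split: if_splits)

section \<open>Ideals\<close>

lemma poly_ring_simps [simp]:
  "carrier (poly_ring n) = {p. Poly_Mapping.keys p \<subseteq> exponents n}"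
  "x \<otimes>\<^bsub>poly_ring n\<^esub> y = x * y" "x \<oplus>\<^bsub>poly_ring n\<^esub> y = x + y"
  "\<one>\<^bsub>poly_ring n\<^esub> = 1" "\<zero>\<^bsub>poly_ring n\<^esub> = 0"
  by (simp_all add: poly_ring_def)

lemma zero_in_exponents [simp]: "0 \<in> exponents n"
  by (simp add: exponents_def)

text \<open>Every ring element is a sum of terms, so closure under multiplication by single terms
  and under addition gives closure under all products. Negation is multiplication by the constant
  term -1.\<close>

lemma poly_ring_idealI:
  fixes I :: "('k::field) mpoly set"
  assumes carr: "\<And>p. p \<in> I \<Longrightarrow> Poly_Mapping.keys p \<subseteq> exponents n"
    and zero: "0 \<in> I"
    and add: "\<And>p q. p \<in> I \<Longrightarrow> q \<in> I \<Longrightarrow> p + q \<in> I"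
    and single: "\<And>c k p. c \<in> exponents n \<Longrightarrow> p \<in> I \<Longrightarrow> Poly_Mapping.single c k * p \<in> I"
  shows "ideal I (poly_ring n)"
proof (rule idealI)
  interpret cring "poly_ring n :: 'k mpoly ring" by (rule cring_poly_ring)
  show "ring (poly_ring n :: 'k mpoly ring)" by (rule ring_axioms)
  have sum: "sum g A \<in> I" if "\<And>a. a \<in> A \<Longrightarrow> g a \<in> I" for g and A :: "(nat \<Rightarrow>\<^sub>0 nat) set"
    using that by (induction A rule: infinite_finite_induct) (auto intro: zero add)
  have mult: "r * p \<in> I" if "p \<in> I" "Poly_Mapping.keys r \<subseteq> exponents n" for r p
  proof -
    have "(\<Sum>a\<in>Poly_Mapping.keys r. Poly_Mapping.single a (Poly_Mapping.lookup r a) * p) \<in> I"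
      by (rule sum, rule single) (use that in auto)
    then show ?thesis by (simp only: sum_distrib_right[symmetric] sum_single_lookup)
  qed
  show "subgroup I (add_monoid (poly_ring n))"
  proof (rule add.subgroupI)
    fix p assume p: "p \<in> I"
    have eq: "Poly_Mapping.single 0 (- 1) * p = - p"
      by (simp add: single_uminus)
    have neg: "- p \<in> I"
      using single[of 0 p "- 1"] p eq by simp
    have "\<ominus>\<^bsub>poly_ring n\<^esub> p = - p"
      by (rule minus_equality) (use carr[OF p] carr[OF neg] in auto)
    with neg show "\<ominus>\<^bsub>poly_ring n\<^esub> p \<in> I" by simp
  qed (use carr zero add in auto)
  fix p r :: "'k mpoly"
  assume "p \<in> I" "r \<in> carrier (poly_ring n)"
  then show "r \<otimes>\<^bsub>poly_ring n\<^esub> p \<in> I" "p \<otimes>\<^bsub>poly_ring n\<^esub> r \<in> I"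
    using mult[of p r] by (simp_all add: mult.commute)
qed

context
  fixes n :: nat and I :: "('k::field) mpoly set"
  assumes ideal: "ideal I (poly_ring n)"
begin

lemma poly_ring_ideal_keys: "p \<in> I \<Longrightarrow> Poly_Mapping.keys p \<subseteq> exponents n"
  using ideal.Icarr[OF ideal] by auto

lemma poly_ring_ideal_zero: "0 \<in> I"
  using additive_subgroup.zero_closed[OF ideal.axioms(1)[OF ideal]] by simp

lemma poly_ring_ideal_add: "p \<in> I \<Longrightarrow> q \<in> I \<Longrightarrow> p + q \<in> I"
  using additive_subgroup.a_closed[OF ideal.axioms(1)[OF ideal], of p q] by simp

lemma poly_ring_ideal_mult: "p \<in> I \<Longrightarrow> Poly_Mapping.keys r \<subseteq> exponents n \<Longrightarrow> r * p \<in> I"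
  using ideal.I_l_closed[OF ideal, of p r] by simp

lemma poly_ring_ideal_single_mult:
  "p \<in> I \<Longrightarrow> c \<in> exponents n \<Longrightarrow> Poly_Mapping.single c k * p \<in> I"
  by (rule poly_ring_ideal_mult) auto

lemma poly_ring_ideal_diff: "p \<in> I \<Longrightarrow> q \<in> I \<Longrightarrow> p - q \<in> I"
  using poly_ring_ideal_add[of p "Poly_Mapping.single 0 (- 1) * q"]
    poly_ring_ideal_single_mult[of q 0 "- 1"]
  by (simp add: single_uminus)

lemma poly_ring_ideal_sum: "(\<And>a. a \<in> A \<Longrightarrow> g a \<in> I) \<Longrightarrow> sum g A \<in> I"
  by (induction A rule: infinite_finite_induct)
    (auto intro: poly_ring_ideal_zero poly_ring_ideal_add)

text \<open>Multiplication by the constant \<open>k / c\<close> changes the coefficient; this uses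
  that the coefficients form a field.\<close>

lemma poly_ring_ideal_single:
  assumes "Poly_Mapping.single a c \<in> I" "c \<noteq> 0"
  shows "Poly_Mapping.single a k \<in> I"
  using poly_ring_ideal_single_mult[OF assms(1), of 0 "k / c"] assms(2)
  by (simp add: mult_single)

end

section \<open>Monomial ideals as upward closed sets of exponents\<close>

definition upward_closed :: "nat \<Rightarrow> (nat \<Rightarrow>\<^sub>0 nat) set \<Rightarrow> bool"
  where "upward_closed n E \<longleftrightarrow>
    E \<subseteq> exponents n \<and> (\<forall>a\<in>E. \<forall>b\<in>exponents n. a + b \<in> E)"

lemma ideal_keys_subset:
  assumes "upward_closed n E"
  shows "ideal {p :: ('k::field) mpoly. Poly_Mapping.keys p \<subseteq> E} (poly_ring n)"
proof (rule poly_ring_idealI, unfold mem_Collect_eq)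
  fix p q :: "'k mpoly"
  assume "Poly_Mapping.keys p \<subseteq> E" "Poly_Mapping.keys q \<subseteq> E"
  then show "Poly_Mapping.keys (p + q) \<subseteq> E"
    using keys_add[of p q] by auto
next
  fix c k and p :: "'k mpoly"
  assume "c \<in> exponents n" "Poly_Mapping.keys p \<subseteq> E"
  then show "Poly_Mapping.keys (Poly_Mapping.single c k * p) \<subseteq> E"
    using assms keys_single_times[of k c p]
    \<comment> \<open>\<open>keys_single_times\<close> covers nonzero \<open>k\<close> only; for
      \<open>k = 0\<close> the product is 0 and has no keys.\<close>
    by (cases "k = 0") (auto simp: upward_closed_def add.commute)
qed (use assms in \<open>auto simp: upward_closed_def\<close>)

text \<open>The polynomials supported in \<open>E\<close> form an ideal containing the generators,
  hence all of \<open>M\<close>; conversely each of them is a sum of terms lying in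
  \<open>M\<close>. Questions about \<open>M\<close> thus become combinatorial questions about
  \<open>E\<close>.\<close>

lemma monomial_ideal_cases:
  fixes M :: "('k::field) mpoly set"
  assumes "monomial_ideal n M"
  obtains E where "upward_closed n E" "M = {p. Poly_Mapping.keys p \<subseteq> E}"
proof -
  interpret cring "poly_ring n :: 'k mpoly ring" by (rule cring_poly_ring)
  from assms obtain S where S: "S \<subseteq> monomials n" and M: "M = Idl\<^bsub>poly_ring n\<^esub> S"
    by (auto simp: monomial_ideal_def)
  have S_carr: "S \<subseteq> carrier (poly_ring n)"
    using S by (auto simp: monomials_def)
  have idM: "ideal M (poly_ring n)"
    unfolding M by (rule genideal_ideal[OF S_carr])
  define E where "E = {a. Poly_Mapping.single a 1 \<in> M}"
  have up: "upward_closed n E"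
    unfolding upward_closed_def
  proof (intro conjI ballI)
    show "E \<subseteq> exponents n"
      using poly_ring_ideal_keys[OF idM] by (fastforce simp: E_def)
    fix a b assume "a \<in> E" "b \<in> exponents n"
    then show "a + b \<in> E"
      using poly_ring_ideal_single_mult[OF idM, of "Poly_Mapping.single a 1" b 1]
      by (simp add: E_def mult_single add.commute)
  qed
  have "M = {p. Poly_Mapping.keys p \<subseteq> E}"
  proof
    have "S \<subseteq> {p. Poly_Mapping.keys p \<subseteq> E}"
      using S genideal_self[OF S_carr] by (fastforce simp: monomials_def E_def M)
    then show "M \<subseteq> {p. Poly_Mapping.keys p \<subseteq> E}"
      unfolding M by (rule genideal_minimal[OF ideal_keys_subset[OF up]])
    show "{p. Poly_Mapping.keys p \<subseteq> E} \<subseteq> M"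
    proof safe
      fix p :: "'k mpoly" assume p: "Poly_Mapping.keys p \<subseteq> E"
      have "(\<Sum>a\<in>Poly_Mapping.keys p. Poly_Mapping.single a (Poly_Mapping.lookup p a)) \<in> M"
        by (rule poly_ring_ideal_sum[OF idM], rule poly_ring_ideal_single[OF idM, of _ 1])
          (use p in \<open>auto simp: E_def\<close>)
      then show "p \<in> M"
        by (simp only: sum_single_lookup)
    qed
  qed
  with up show thesis by (rule that)
qed

section \<open>The ideal generated by the monomials of an ideal\<close>

lemma mono_ideal_subset:
  assumes "ideal I (poly_ring n)"
  shows "mono_ideal n I \<subseteq> I"
proof -
  interpret cring "poly_ring n :: 'a mpoly ring" by (rule cring_poly_ring)
  show ?thesis
    unfolding mono_ideal_def using assms by (rule genideal_minimal) auto
qed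

lemma monomial_in_mono_ideal:
  assumes "Poly_Mapping.single a 1 \<in> I" "a \<in> exponents n"
  shows "Poly_Mapping.single a 1 \<in> mono_ideal n I"
proof -
  interpret cring "poly_ring n :: 'a mpoly ring" by (rule cring_poly_ring)
  have "I \<inter> monomials n \<subseteq> mono_ideal n I"
    unfolding mono_ideal_def by (rule genideal_self) (auto simp: monomials_def)
  with assms show ?thesis by (auto simp: monomials_def)
qed

lemma monomial_ideal_mono_ideal: "monomial_ideal n (mono_ideal n I)"
  by (auto simp: monomial_ideal_def mono_ideal_def)

lemma colon_single:
  "colon n {p. Poly_Mapping.keys p \<subseteq> E} (Poly_Mapping.single u (1::'k::field)) =
    {r. Poly_Mapping.keys r \<subseteq> {b \<in> exponents n. u + b \<in> E}}"
  by (auto simp: colon_def mult.commute[of _ "Poly_Mapping.single u 1"] keys_single_times)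

lemma keys_subset_Collect_eq_iff:
  "{r :: ('k::field) mpoly. Poly_Mapping.keys r \<subseteq> A} = {r. Poly_Mapping.keys r \<subseteq> B} \<longleftrightarrow> A = B"
proof
  assume eq: "{r :: 'k mpoly. Poly_Mapping.keys r \<subseteq> A} = {r. Poly_Mapping.keys r \<subseteq> B}"
  have "a \<in> A \<longleftrightarrow> a \<in> B" for a
    using eqset_imp_iff[OF eq, of "Poly_Mapping.single a 1"] by simp
  then show "A = B" by blast
qed simp

lemma colon_single_eq_iff:
  "colon n {p. Poly_Mapping.keys p \<subseteq> E} (Poly_Mapping.single u (1::'k::field)) =
     colon n {p. Poly_Mapping.keys p \<subseteq> E} (Poly_Mapping.single v 1) \<longleftrightarrow>
   (\<forall>b\<in>exponents n. u + b \<in> E \<longleftrightarrow> v + b \<in> E)"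
  unfolding colon_single keys_subset_Collect_eq_iff by auto

section \<open>From graded ideals to monomials\<close>

lemma homogeneous_diff_term:
  fixes p :: "('k::field) mpoly"
  assumes "\<forall>a\<in>Poly_Mapping.keys p. exp_degree a = d"
  shows "\<forall>a\<in>Poly_Mapping.keys (p - Poly_Mapping.single b (Poly_Mapping.lookup p b)).
    exp_degree a = d"
  using assms by (auto simp: keys_minus_term)

lemma exists_equal_colon_if_graded_ideal:
  fixes I :: "('k::field) mpoly set"
  assumes graded: "graded_ideal n I" and not_mono: "\<not> monomial_ideal n I"
    and mono: "mono_ideal n I = {p. Poly_Mapping.keys p \<subseteq> E}" and up: "upward_closed n E"
  shows "\<exists>u v. u \<in> exponents n \<and> v \<in> exponents n \<and> u \<noteq> v \<and> u \<notin> E \<and> v \<notin> E \<and>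
    exp_degree u = exp_degree v \<and> (\<forall>b\<in>exponents n. u + b \<in> E \<longleftrightarrow> v + b \<in> E)"
proof -
  have idI: "ideal I (poly_ring n)" and comp: "\<And>p d. p \<in> I \<Longrightarrow> homogeneous_component d p \<in> I"
    using graded by (auto simp: graded_ideal_def)
  have mono_I: "p \<in> I" if "Poly_Mapping.keys p \<subseteq> E" for p :: "'k mpoly"
    using that mono mono_ideal_subset[OF idI] by auto
  have "I \<noteq> mono_ideal n I"
    using not_mono monomial_ideal_mono_ideal[of n I] by metis
  then obtain p where p: "p \<in> I" "\<not> Poly_Mapping.keys p \<subseteq> E"
    using mono mono_I by blast
  then obtain a where a: "a \<in> Poly_Mapping.keys p" "a \<notin> E" by blast
  \<comment> \<open>\<open>P\<close> describes the homogeneous elements of \<open>I\<close> outside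
    \<open>mono(I)\<close>; a counterexample with fewest terms is chosen among them.\<close>
  define P where "P q \<longleftrightarrow> q \<in> I \<and> \<not> Poly_Mapping.keys q \<subseteq> E \<and>
    (\<exists>d. \<forall>a\<in>Poly_Mapping.keys q. exp_degree a = d)" for q
  \<comment> \<open>The component in the degree of \<open>a\<close> still has the key
    \<open>a\<close>, so it stays outside \<open>mono(I)\<close>.\<close>
  have "P (homogeneous_component (exp_degree a) p)"
    using p a by (auto simp: P_def comp keys_homogeneous_component)
  then obtain f where f: "P f"
    and min: "\<And>q. P q \<Longrightarrow> card (Poly_Mapping.keys f) \<le> card (Poly_Mapping.keys q)"
    using ex_has_least_nat[of P _ "\<lambda>q. card (Poly_Mapping.keys q)"] by metis
  from f obtain d where fI: "f \<in> I" and fE: "\<not> Poly_Mapping.keys f \<subseteq> E"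
    and fd: "\<forall>a\<in>Poly_Mapping.keys f. exp_degree a = d"
    by (auto simp: P_def)
  have f_exp: "Poly_Mapping.keys f \<subseteq> exponents n"
    by (rule poly_ring_ideal_keys[OF idI fI])
  \<comment> \<open>If a key other than \<open>b\<close> lay outside \<open>E\<close>, removing the
    term at \<open>b\<close>, which is in \<open>I\<close> because \<open>b\<close> is in
    \<open>E\<close>, would leave an element satisfying \<open>P\<close> with fewer terms than
    \<open>f\<close>. The claim is stated for general \<open>q\<close> because it is applied both to
    \<open>f\<close> and to monomial multiples of \<open>f\<close>.\<close>
  have less: "Poly_Mapping.keys q - {b} \<subseteq> E"
    if q: "q \<in> I" "\<forall>a\<in>Poly_Mapping.keys q. exp_degree a = e" "b \<in> Poly_Mapping.keys q" "b \<in> E"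
      and card: "card (Poly_Mapping.keys q) = card (Poly_Mapping.keys f)" for q b e
  proof (rule ccontr)
    let ?q = "q - Poly_Mapping.single b (Poly_Mapping.lookup q b)"
    assume neg: "\<not> Poly_Mapping.keys q - {b} \<subseteq> E"
    have "?q \<in> I"
      by (intro poly_ring_ideal_diff[OF idI] q mono_I) (use q in auto)
    then have "P ?q"
      unfolding P_def using neg homogeneous_diff_term[OF q(2)] by (simp only: keys_minus_term) blast
    from min[OF this] show False
      using q(3) card card_Diff1_less[OF finite_keys q(3)] by (simp add: keys_minus_term)
  qed
  \<comment> \<open>One key of \<open>f\<close> in \<open>E\<close> would force all the others into
    \<open>E\<close> by \<open>less\<close>, contradicting \<open>fE\<close>.\<close>
  have f_disj: "b \<notin> E" if "b \<in> Poly_Mapping.keys f" for b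
    using less[OF fI fd that] that fE by auto
  obtain u where u: "u \<in> Poly_Mapping.keys f" using fE by blast
  \<comment> \<open>A one-term \<open>f\<close> could be rescaled to a monomial of \<open>I\<close>,
    which would belong to \<open>mono(I)\<close>.\<close>
  have "Poly_Mapping.keys f \<noteq> {u}"
  proof
    assume keys: "Poly_Mapping.keys f = {u}"
    then have "Poly_Mapping.single u (Poly_Mapping.lookup f u) = f"
      using sum_single_lookup[of f] by simp
    then have "Poly_Mapping.single u 1 \<in> I"
      using poly_ring_ideal_single[OF idI, of u "Poly_Mapping.lookup f u" 1] u fI
      by (auto simp: in_keys_iff)
    then have "Poly_Mapping.single u 1 \<in> mono_ideal n I"
      using u f_exp by (intro monomial_in_mono_ideal) auto
    then show False using f_disj[OF u] by (simp add: mono)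
  qed
  then obtain v where v: "v \<in> Poly_Mapping.keys f" "v \<noteq> u" using u by blast
  \<comment> \<open>The product of \<open>f\<close> with the monomial of exponent \<open>b\<close>
    is homogeneous and has as many terms as \<open>f\<close>. Its key \<open>b + u'\<close> lies in
    \<open>E\<close>, so \<open>less\<close> forces the key \<open>b + v'\<close> into
    \<open>E\<close> too.\<close>
  have step: "v' + b \<in> E"
    if "b \<in> exponents n" "u' \<in> Poly_Mapping.keys f" "v' \<in> Poly_Mapping.keys f" "u' \<noteq> v'"
      "u' + b \<in> E" for u' v' b
  proof -
    let ?q = "Poly_Mapping.single b 1 * f"
    have keys: "Poly_Mapping.keys ?q = (+) b ` Poly_Mapping.keys f"
      by (simp add: keys_single_times)
    have "Poly_Mapping.keys ?q - {b + u'} \<subseteq> E"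
    proof (rule less)
      show "?q \<in> I" using that by (intro poly_ring_ideal_single_mult[OF idI] fI)
      show "\<forall>a\<in>Poly_Mapping.keys ?q. exp_degree a = exp_degree b + d"
        using fd by (auto simp: keys exp_degree_add)
      show "card (Poly_Mapping.keys ?q) = card (Poly_Mapping.keys f)"
        by (simp add: keys card_image)
    qed (use that in \<open>auto simp: keys add.commute\<close>)
    moreover have "b + v' \<in> Poly_Mapping.keys ?q - {b + u'}"
      using that by (auto simp: keys)
    ultimately show ?thesis by (auto simp: add.commute)
  qed
  show ?thesis
  proof (intro exI conjI ballI)
    show "exp_degree u = exp_degree v" using fd u v by simp
    show "u + b \<in> E \<longleftrightarrow> v + b \<in> E" if "b \<in> exponents n" for b
      using step[OF that u v(1)] step[OF that v(1) u] v(2) by blast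
  qed (use u v f_exp f_disj in blast)+
qed

section \<open>From monomials to graded ideals\<close>

definition pairing :: "('k::field) mpoly \<Rightarrow> ((nat \<Rightarrow>\<^sub>0 nat) \<Rightarrow> 'k) \<Rightarrow> 'k"
  where "pairing p g = (\<Sum>a\<in>Poly_Mapping.keys p. Poly_Mapping.lookup p a * g a)"

lemma pairing_superset:
  assumes "finite A" "Poly_Mapping.keys p \<subseteq> A"
  shows "pairing p g = (\<Sum>a\<in>A. Poly_Mapping.lookup p a * g a)"
  unfolding pairing_def
  using assms by (intro sum.mono_neutral_left) (auto simp: in_keys_iff)

lemma pairing_zero [simp]: "pairing 0 g = 0"
  by (simp add: pairing_def)

lemma pairing_single [simp]: "pairing (Poly_Mapping.single a k) g = k * g a"
  by (subst pairing_superset[of "{a}"]) auto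

lemma pairing_add: "pairing (p + q) g = pairing p g + pairing q g"
proof -
  let ?A = "Poly_Mapping.keys p \<union> Poly_Mapping.keys q"
  have *: "pairing r g = (\<Sum>a\<in>?A. Poly_Mapping.lookup r a * g a)"
    if "Poly_Mapping.keys r \<subseteq> ?A" for r
    using that by (intro pairing_superset) auto
  show ?thesis
    using keys_add[of p q] by (simp add: * lookup_add distrib_right sum.distrib)
qed

text \<open>Multiplication by a term is moved from the polynomial to the weight, where it becomes a
  shift. Closure of an annihilator under multiplication then follows from closure of its weights
  under shifts.\<close>

lemma pairing_single_times:
  "pairing (Poly_Mapping.single c k * p) g = k * pairing p (\<lambda>a. g (c + a))"
proof (cases "k = 0")
  case False
  have "pairing (Poly_Mapping.single c k * p) g =
    (\<Sum>a\<in>(+) c ` Poly_Mapping.keys p. Poly_Mapping.lookup (Poly_Mapping.single c k * p) a * g a)"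
    using False by (simp add: pairing_def keys_single_times)
  also have "\<dots> = (\<Sum>a\<in>Poly_Mapping.keys p. k * Poly_Mapping.lookup p a * g (c + a))"
    by (subst sum.reindex) (auto simp: lookup_single_times)
  finally show ?thesis
    by (simp add: pairing_def sum_distrib_left mult.assoc)
qed simp

text \<open>Likewise, taking a component is moved to the weight, where it becomes truncation to one
  degree.\<close>

lemma pairing_homogeneous_component:
  "pairing (homogeneous_component e p) g = pairing p (\<lambda>a. if exp_degree a = e then g a else 0)"
proof -
  have "pairing (homogeneous_component e p) g =
      (\<Sum>a\<in>Poly_Mapping.keys p. Poly_Mapping.lookup (homogeneous_component e p) a * g a)"
    by (rule pairing_superset) (auto simp: keys_homogeneous_component)
  then show ?thesis
    by (auto simp: pairing_def lookup_homogeneous_component intro: sum.cong)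
qed

text \<open>Allowing every \<open>j\<close> here, instead of only \<open>j = 0\<close>, avoids the truncated subtraction
  \<open>d - exp_degree c\<close> when the functional is composed with multiplication by \<open>x\<^sup>c\<close>.\<close>

definition outside :: "(nat \<Rightarrow>\<^sub>0 nat) set \<Rightarrow> nat \<Rightarrow> nat \<Rightarrow> (nat \<Rightarrow>\<^sub>0 nat) \<Rightarrow> (nat \<Rightarrow>\<^sub>0 nat) \<Rightarrow> 'k::field"
  where "outside E d j b a = (if exp_degree a + j = d \<and> a + b \<notin> E then 1 else 0)"

text \<open>For \<open>j \<le> d\<close>, pairing \<open>p\<close> with
  \<open>outside E d j b\<close> multiplies the component of \<open>p\<close> of degree
  \<open>d - j\<close> by the monomial of exponent \<open>b\<close> and sums the coefficients
  outside \<open>E\<close>; for \<open>j > d\<close> the weight is zero. Ranging over all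
  \<open>b\<close> and all degrees makes the common annihilator both an ideal and graded.\<close>

definition largest_graded :: "nat \<Rightarrow> (nat \<Rightarrow>\<^sub>0 nat) set \<Rightarrow> ('k::field) mpoly set"
  where "largest_graded n E = {p. Poly_Mapping.keys p \<subseteq> exponents n \<and>
    (\<forall>b\<in>exponents n. \<forall>d j. pairing p (outside E d j b) = 0)}"

text \<open>The family of weights is closed under shifts: the degree of \<open>c\<close> is absorbed
  into \<open>j\<close>, and \<open>c\<close> itself into \<open>b\<close>.\<close>

lemma outside_shift: "outside E d j b (c + a) = outside E d (exp_degree c + j) (c + b) a"
  by (simp add: outside_def exp_degree_add ac_simps)

lemma ideal_largest_graded: "ideal (largest_graded n E :: ('k::field) mpoly set) (poly_ring n)"
proof (rule poly_ring_idealI)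
  fix c k and p :: "'k mpoly"
  assume c: "c \<in> exponents n" and p: "p \<in> largest_graded n E"
  have "Poly_Mapping.keys (Poly_Mapping.single c k * p) \<subseteq> exponents n"
    using p exponents_add[OF c] keys_single_times[of k c p]
    by (cases "k = 0") (auto simp: largest_graded_def)
  then show "Poly_Mapping.single c k * p \<in> largest_graded n E"
    using p exponents_add[OF c]
    by (auto simp: largest_graded_def pairing_single_times outside_shift)
next
  fix p q :: "'k mpoly"
  assume "p \<in> largest_graded n E" "q \<in> largest_graded n E"
  then show "p + q \<in> largest_graded n E"
    using keys_add[of p q] by (auto simp: largest_graded_def pairing_add)
qed (auto simp: largest_graded_def)

lemma graded_largest_graded: "graded_ideal n (largest_graded n E :: ('k::field) mpoly set)"
  unfolding graded_ideal_def
proof (intro conjI ideal_largest_graded ballI allI)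
  fix p :: "'k mpoly" and e
  assume p: "p \<in> largest_graded n E"
  have "pairing p (\<lambda>a. if exp_degree a = e then outside E d j b a else 0) = 0"
    if "b \<in> exponents n" for b d j
  \<comment> \<open>The weight is supported on exponents of degree \<open>e\<close> with
    \<open>e + j = d\<close>, so truncation to degree \<open>e\<close> either leaves it unchanged or
    makes it zero.\<close>
  proof (cases "e + j = d")
    case True
    then have "(\<lambda>a. if exp_degree a = e then outside E d j b a else 0) =
        (outside E d j b :: _ \<Rightarrow> 'k)"
      by (auto simp: outside_def fun_eq_iff)
    then show ?thesis using p that by (simp add: largest_graded_def)
  next
    case False
    then have "(\<lambda>a. if exp_degree a = e then outside E d j b a else 0) = (\<lambda>_. 0 :: 'k)"
      by (auto simp: outside_def fun_eq_iff)
    then show ?thesis by (simp add: pairing_def)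
  qed
  then show "homogeneous_component e p \<in> largest_graded n E"
    using p
    by (auto simp: largest_graded_def pairing_homogeneous_component keys_homogeneous_component)
qed

lemma single_in_largest_graded_iff:
  assumes "upward_closed n E"
  shows "Poly_Mapping.single a (1::'k::field) \<in> largest_graded n E \<longleftrightarrow> a \<in> E"
proof
  assume "Poly_Mapping.single a (1::'k) \<in> largest_graded n E"
  \<comment> \<open>The weight with \<open>b = 0\<close>, \<open>j = 0\<close> and \<open>d\<close>
    the degree of \<open>a\<close> is 1 at \<open>a\<close> exactly when \<open>a\<close> is outside
    \<open>E\<close>.\<close>
  then have "(outside E (exp_degree a) 0 0 a :: 'k) = 0"
    by (simp add: largest_graded_def)
  then show "a \<in> E" by (simp add: outside_def split: if_splits)
qed (use assms in \<open>auto simp: largest_graded_def outside_def upward_closed_def\<close>)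

text \<open>By \<open>single_in_largest_graded_iff\<close>, this ideal and \<open>M\<close> contain
  the same monomials. These include the generators of \<open>M\<close>, so they generate
  \<open>M\<close>.\<close>

lemma mono_ideal_largest_graded:
  fixes M :: "('k::field) mpoly set"
  assumes mon: "monomial_ideal n M" and up: "upward_closed n E"
    and M: "M = {p. Poly_Mapping.keys p \<subseteq> E}"
  shows "mono_ideal n (largest_graded n E) = M"
proof -
  from mon obtain S where S: "S \<subseteq> monomials n" and MS: "M = Idl\<^bsub>poly_ring n\<^esub> S"
    by (auto simp: monomial_ideal_def)
  interpret cring "poly_ring n :: 'k mpoly ring" by (rule cring_poly_ring)
  have sub: "largest_graded n E \<inter> monomials n \<subseteq> M"
    by (auto simp: monomials_def M single_in_largest_graded_iff[OF up])
  have S_sub: "S \<subseteq> M"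
    unfolding MS using S by (intro genideal_self) (auto simp: monomials_def)
  have "S \<subseteq> largest_graded n E \<inter> monomials n"
    using S S_sub by (fastforce simp: monomials_def M single_in_largest_graded_iff[OF up])
  then have "M \<subseteq> mono_ideal n (largest_graded n E)"
    unfolding mono_ideal_def MS by (intro subset_Idl_subset) (auto simp: monomials_def)
  moreover have "mono_ideal n (largest_graded n E) \<subseteq> M"
    unfolding mono_ideal_def
    by (rule genideal_minimal[OF _ sub]) (use ideal_keys_subset[OF up] M in simp)
  ultimately show ?thesis by blast
qed

lemma not_monomial_largest_graded:
  assumes up: "upward_closed n E" and u: "u \<in> exponents n" "u \<notin> E" and v: "v \<in> exponents n"
    and neq: "u \<noteq> v" and deg: "exp_degree u = exp_degree v"
    and colon: "\<forall>b\<in>exponents n. u + b \<in> E \<longleftrightarrow> v + b \<in> E"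
  shows "\<not> monomial_ideal n (largest_graded n E :: ('k::field) mpoly set)"
proof
  assume "monomial_ideal n (largest_graded n E :: 'k mpoly set)"
  then obtain F where F: "largest_graded n E = {p :: 'k mpoly. Poly_Mapping.keys p \<subseteq> F}"
    by (rule monomial_ideal_cases)
  \<comment> \<open>The difference of the two monomials, written as a sum so that
    \<open>pairing_add\<close> and \<open>pairing_single\<close> apply.\<close>
  let ?p = "Poly_Mapping.single u 1 + Poly_Mapping.single v (- 1) :: 'k mpoly"
  have "Poly_Mapping.keys ?p \<subseteq> exponents n"
    using keys_add[of "Poly_Mapping.single u 1" "Poly_Mapping.single v (- 1 :: 'k)"] u v by auto
  \<comment> \<open>Equal degrees and equal colon conditions give \<open>u\<close> and
    \<open>v\<close> the same value under every weight, so the coefficients 1 and -1 cancel.\<close>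
  then have "?p \<in> largest_graded n E"
    using colon by (auto simp: largest_graded_def pairing_add outside_def deg)
  moreover have "u \<in> Poly_Mapping.keys ?p"
    using neq by (simp add: in_keys_iff lookup_add lookup_single when_def)
  \<comment> \<open>A monomial ideal contains each term of its elements separately.\<close>
  ultimately have "Poly_Mapping.single u (1::'k) \<in> largest_graded n E"
    unfolding F by auto
  then show False
    using single_in_largest_graded_iff[OF up] u by blast
qed

theorem theorem4p4:
  fixes n :: nat and M :: "('k::field) mpoly set"
  assumes "monomial_ideal n M"
  shows "((\<exists>I. graded_ideal n I \<and> \<not> monomial_ideal n I \<and> mono_ideal n I = M)
            \<longleftrightarrow> (\<exists>t\<ge>2. \<exists>u :: nat \<Rightarrow> 'k mpoly.
                  inj_on u {1..t} \<and>
                  (\<forall>i\<in>{1..t}. u i \<in> monomials n \<and> u i \<notin> M) \<and>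
                  (\<forall>i\<in>{1..t}. \<forall>j\<in>{1..t}. total_degree (u i) = total_degree (u j)) \<and>
                  (\<forall>i\<in>{1..t}. \<forall>j\<in>{1..t}. colon n M (u i) = colon n M (u j)))) \<and>
         ((\<exists>t\<ge>2. \<exists>u :: nat \<Rightarrow> 'k mpoly.
                  inj_on u {1..t} \<and>
                  (\<forall>i\<in>{1..t}. u i \<in> monomials n \<and> u i \<notin> M) \<and>
                  (\<forall>i\<in>{1..t}. \<forall>j\<in>{1..t}. total_degree (u i) = total_degree (u j)) \<and>
                  (\<forall>i\<in>{1..t}. \<forall>j\<in>{1..t}. colon n M (u i) = colon n M (u j)))
            \<longleftrightarrow> (\<exists>u1\<in>monomials n. \<exists>u2\<in>monomials n.
                  u1 \<noteq> u2 \<and> u1 \<notin> M \<and> u2 \<notin> M \<and>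
                  total_degree u1 = total_degree u2 \<and> colon n M u1 = colon n M u2))"
    (is "(?graded \<longleftrightarrow> ?family) \<and> (?family \<longleftrightarrow> ?pair)")
proof -
  from assms obtain E where up: "upward_closed n E" and M: "M = {p. Poly_Mapping.keys p \<subseteq> E}"
    by (rule monomial_ideal_cases)
  have family_pair: ?pair if ?family
    using that
  proof (elim exE conjE)
    fix t :: nat and u :: "nat \<Rightarrow> 'k mpoly"
    assume t: "t \<ge> 2" and inj: "inj_on u {1..t}"
      and *: "\<forall>i\<in>{1..t}. u i \<in> monomials n \<and> u i \<notin> M"
        "\<forall>i\<in>{1..t}. \<forall>j\<in>{1..t}. total_degree (u i) = total_degree (u j)"
        "\<forall>i\<in>{1..t}. \<forall>j\<in>{1..t}. colon n M (u i) = colon n M (u j)"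
    \<comment> \<open>The bound on \<open>t\<close> puts both indices 1 and 2 in range.\<close>
    have mem: "1 \<in> {1..t}" "2 \<in> {1..t}" using t by auto
    then have "u 1 \<noteq> u 2" using inj_onD[OF inj, of 1 2] by auto
    with * mem show ?pair by blast
  qed
  have pair_family: ?family if ?pair
    using that
  proof (elim bexE conjE)
    fix u1 u2 assume "u1 \<in> monomials n" "u2 \<in> monomials n" "u1 \<noteq> u2" "u1 \<notin> M" "u2 \<notin> M"
      "total_degree u1 = total_degree u2" "colon n M u1 = colon n M u2"
    then show ?family
      by (intro exI[of _ 2] conjI exI[of _ "\<lambda>i::nat. if i = 1 then u1 else u2"])
        (auto simp: inj_on_def)
  qed
  have graded_pair: ?pair if ?graded
    using that
  proof (elim exE conjE)
    fix I assume "graded_ideal n I" "\<not> monomial_ideal n I" "mono_ideal n I = M"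
    from exists_equal_colon_if_graded_ideal[OF this[unfolded M] up]
    obtain u v where "u \<in> exponents n" "v \<in> exponents n" "u \<noteq> v" "u \<notin> E" "v \<notin> E"
      "exp_degree u = exp_degree v" "\<forall>b\<in>exponents n. u + b \<in> E \<longleftrightarrow> v + b \<in> E" by blast
    then show ?pair
      unfolding M
      by (intro bexI[of _ "Poly_Mapping.single u 1"] bexI[of _ "Poly_Mapping.single v 1"])
        (simp_all add: colon_single_eq_iff total_degree_single monomials_def single_1_eq_iff)
  qed
  have pair_graded: ?graded if ?pair
    using that
  proof (elim bexE conjE)
    fix u1 u2 :: "'k mpoly"
    assume *: "u1 \<in> monomials n" "u2 \<in> monomials n" "u1 \<noteq> u2" "u1 \<notin> M" "u2 \<notin> M"
      "total_degree u1 = total_degree u2" "colon n M u1 = colon n M u2"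
    then obtain u v where uv: "u1 = Poly_Mapping.single u 1" "u2 = Poly_Mapping.single v 1"
      "u \<in> exponents n" "v \<in> exponents n"
      by (auto simp: monomials_def)
    have "\<not> monomial_ideal n (largest_graded n E :: 'k mpoly set)"
    proof (rule not_monomial_largest_graded[OF up, of u v])
      show "u \<notin> E" using * by (simp add: uv M)
      show "u \<noteq> v" using * by (auto simp: uv)
      show "exp_degree u = exp_degree v" using * by (simp add: uv total_degree_single)
      show "\<forall>b\<in>exponents n. u + b \<in> E \<longleftrightarrow> v + b \<in> E"
        using *(7) unfolding uv M colon_single_eq_iff .
    qed (use uv in auto)
    then show ?graded
      using graded_largest_graded mono_ideal_largest_graded[OF assms up M] by blast
  qed
  \<comment> \<open>Both equivalences are routed through the pair: the graded ideal and the family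
    are each compared with it.\<close>
  show ?thesis
    by (intro conjI iffI)
      (fact pair_family[OF graded_pair] pair_graded[OF family_pair] family_pair pair_family)+
qed

end
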